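(* Let $\mathbb C$ be a comonad on the category $\mathbf{Graph}$ which classifies a monotone class $\Delta$ of finite graphs. Then $\Delta$ is nowhere dense if and only if there is no comonad morphism $\mathbb D_{\mathbf{Cli}_p}\Rightarrow\mathbb C$ for any $p\in\mathbb N$.
   Context: $\mathbf{Graph}$ is the category of undirected loopless graphs (possibly infinite or empty) and edge-preserving functions; coproducts are disjoint unions. A class $\Delta$ of finite graphs is monotone if it is closed under taking (not necessarily induced) subgraphs. For $n\ge1$ and $p\in\mathbb N$, $K_n^p$ denotes the $p$-th subdivision of the complete graph $K_n$: every edge is replaced by a path through $p$ new vertices. $\Delta$ is somewhere dense if there is $p\in\mathbb N$ such that for every $n$ the graph $K_n^p$ is (isomorphic to) a subgraph of some graph in $\Delta$; it is nowhere dense if it is not somewhere dense. $\mathbf{Cli}_p=\{K_n^p\mid n\in\mathbb N,\ n\ge 1\}$, regarded as a discrete category. $\mathbb D_{\mathbf{Cli}_p}$ is the density comonad of the inclusion of $\mathbf{Cli}_p$ into $\mathbf{Graph}$: $\mathbb D_{\mathbf{Cli}_p}(B)=\coprod_{A\in\mathbf{Cli}_p}\coprod_{f\colon A\to B}A$, with $\iota_f\colon A\to\mathbb D_{\mathbf{Cli}_p}(B)$ the inclusion of the summand indexed by $f$; on morphisms $h\colon B\to B'$, $\mathbb D_{\mathbf{Cli}_p}(h)\circ\iota_f=\iota_{h\circ f}$; counit and comultiplication are determined by $\varepsilon_B\circ\iota_f=f$ and $\delta_B\circ\iota_f=\iota_{\iota_f}$. A coalgebra for a comonad $(\mathbb C,\varepsilon,\delta)$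 on $X$ is a morphism $\alpha\colon X\to\mathbb C(X)$ with $\varepsilon_X\circ\alpha=\mathrm{id}$ and $\delta_X\circ\alpha=\mathbb C(\alpha)\circ\alpha$. $\mathbb C$ classifies $\Delta$ if for every finite graph $X$: $X\in\Delta$ iff $X$ admits a $\mathbb C$-coalgebra. A comonad morphism $\lambda\colon\mathbb D\Rightarrow\mathbb C$ is a natural transformation with $\varepsilon^{\mathbb C}\circ\lambda=\varepsilon^{\mathbb D}$ and $\delta^{\mathbb C}\circ\lambda=\lambda\mathbb C\circ\mathbb D\lambda\circ\delta^{\mathbb D}$. *)

theory Defs
  imports
    "Graph_Theory.Digraph_Component"
    "Graph_Theory.Digraph_Isomorphism"
    "Graph_Theory.Pair_Digraph"
    "HOL-Library.FuncSet"
    "HOL-Library.Equipollence"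
begin

record ('o, 'm) category =
  Obj :: "'o set"
  Arr :: "'m set"
  Dom :: "'m \<Rightarrow> 'o"
  Cod :: "'m \<Rightarrow> 'o"
  Ident :: "'o \<Rightarrow> 'm"
  Comp :: "'m \<Rightarrow> 'm \<Rightarrow> 'm"  (infixl \<open>\<odot>\<index>\<close> 70)

definition hom :: "('o, 'm) category \<Rightarrow> 'o \<Rightarrow> 'o \<Rightarrow> 'm set" where
  "hom \<X> A B = {f \<in> Arr \<X>. Dom \<X> f = A \<and> Cod \<X> f = B}"

locale category =
  fixes \<X> :: "('o, 'm) category" (structure)
  assumes Dom_in_Obj: "f \<in> Arr \<X> \<Longrightarrow> Dom \<X> f \<in> Obj \<X>"
    and Cod_in_Obj: "f \<in> Arr \<X> \<Longrightarrow> Cod \<X> f \<in> Obj \<X>"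
    and Ident_in_hom: "A \<in> Obj \<X> \<Longrightarrow> Ident \<X> A \<in> hom \<X> A A"
    and Comp_in_hom: "\<lbrakk>f \<in> hom \<X> A B; g \<in> hom \<X> B D\<rbrakk> \<Longrightarrow> g \<odot> f \<in> hom \<X> A D"
    and Comp_Ident: "f \<in> hom \<X> A B \<Longrightarrow> f \<odot> Ident \<X> A = f"
    and Ident_Comp: "f \<in> hom \<X> A B \<Longrightarrow> Ident \<X> B \<odot> f = f"
    and Comp_assoc: "\<lbrakk>f \<in> hom \<X> A B; g \<in> hom \<X> B D; h \<in> hom \<X> D E\<rbrakk>
      \<Longrightarrow> (h \<odot> g) \<odot> f = h \<odot> (g \<odot> f)"

record ('o, 'm) comonad_data =
  Fobj :: "'o \<Rightarrow> 'o"
  Farr :: "'m \<Rightarrow> 'm"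
  Counit :: "'o \<Rightarrow> 'm"
  Comult :: "'o \<Rightarrow> 'm"

locale comonad = category \<X> for \<X> :: "('o, 'm) category" (structure) +
  fixes T :: "('o, 'm) comonad_data"
  assumes Fobj_in_Obj: "A \<in> Obj \<X> \<Longrightarrow> Fobj T A \<in> Obj \<X>"
    and Farr_in_hom: "f \<in> hom \<X> A B \<Longrightarrow> Farr T f \<in> hom \<X> (Fobj T A) (Fobj T B)"
    and Farr_Ident: "A \<in> Obj \<X> \<Longrightarrow> Farr T (Ident \<X> A) = Ident \<X> (Fobj T A)"
    and Farr_Comp: "\<lbrakk>f \<in> hom \<X> A B; g \<in> hom \<X> B D\<rbrakk>
      \<Longrightarrow> Farr T (g \<odot> f) = Farr T g \<odot> Farr T f"
    and Counit_in_hom: "A \<in> Obj \<X> \<Longrightarrow> Counit T A \<in> hom \<X> (Fobj T A) A"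
    and Counit_natural: "f \<in> hom \<X> A B \<Longrightarrow> Counit T B \<odot> Farr T f = f \<odot> Counit T A"
    and Comult_in_hom: "A \<in> Obj \<X> \<Longrightarrow> Comult T A \<in> hom \<X> (Fobj T A) (Fobj T (Fobj T A))"
    and Comult_natural: "f \<in> hom \<X> A B
      \<Longrightarrow> Comult T B \<odot> Farr T f = Farr T (Farr T f) \<odot> Comult T A"
    and Counit_Comult: "A \<in> Obj \<X>
      \<Longrightarrow> Counit T (Fobj T A) \<odot> Comult T A = Ident \<X> (Fobj T A)"
    and Farr_Counit_Comult: "A \<in> Obj \<X>
      \<Longrightarrow> Farr T (Counit T A) \<odot> Comult T A = Ident \<X> (Fobj T A)"
    and Comult_Comult: "A \<in> Obj \<X>
      \<Longrightarrow> Comult T (Fobj T A) \<odot> Comult T A = Farr T (Comult T A) \<odot> Comult T A"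

definition coalgebra ::
  "('o, 'm) category \<Rightarrow> ('o, 'm) comonad_data \<Rightarrow> 'o \<Rightarrow> 'm \<Rightarrow> bool" where
  "coalgebra \<X> T A \<alpha> \<longleftrightarrow>
    A \<in> Obj \<X> \<and> \<alpha> \<in> hom \<X> A (Fobj T A) \<and>
    Counit T A \<odot>\<^bsub>\<X>\<^esub> \<alpha> = Ident \<X> A \<and>
    Comult T A \<odot>\<^bsub>\<X>\<^esub> \<alpha> = Farr T \<alpha> \<odot>\<^bsub>\<X>\<^esub> \<alpha>"

locale comonad_morphism =
  source: comonad \<X> D + target: comonad \<X> C
  for \<X> :: "('o, 'm) category" (structure)
    and D :: "('o, 'm) comonad_data"
    and C :: "('o, 'm) comonad_data" +
  fixes l :: "'o \<Rightarrow> 'm"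
  assumes component_in_hom: "A \<in> Obj \<X> \<Longrightarrow> l A \<in> hom \<X> (Fobj D A) (Fobj C A)"
    and natural: "f \<in> hom \<X> A B \<Longrightarrow> l B \<odot> Farr D f = Farr C f \<odot> l A"
    and preserves_Counit: "A \<in> Obj \<X> \<Longrightarrow> Counit C A \<odot> l A = Counit D A"
    and preserves_Comult: "A \<in> Obj \<X>
      \<Longrightarrow> Comult C A \<odot> l A = l (Fobj C A) \<odot> Farr D (l A) \<odot> Comult D A"


text \<open>
  The smallness notion delimiting the universe: vertex sets are subsets of \<^typ>\<open>'u\<close> belonging
  to a family closed under passing to sets of at most the same cardinality and containing an
  infinite set. Thus either all subsets of an infinite type are small, or the sets of cardinality
  less than some uncountable cardinal. For an inaccessible cardinal the latter gives the graphs
  in the corresponding Grothendieck universe.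
\<close>

definition small_sets :: "'u set set \<Rightarrow> bool" where
  "small_sets S \<longleftrightarrow> (\<exists>M\<in>S. infinite M) \<and> (\<forall>M\<in>S. \<forall>N. N \<lesssim> M \<longrightarrow> N \<in> S)"

text \<open>
  An undirected loopless graph is a symmetric loop-free pair digraph, i.e. an instance of
  \<^locale>\<open>pair_bidirected_digraph\<close>, which allows empty and infinite graphs; the
  finite ones are the instances of \<^locale>\<open>pair_graph\<close>.

  Arrows carry their source and target; the underlying function is normalised to be
  \<^term>\<open>undefined\<close> outside the vertex set of the source, so that equality of arrows
  is equality of functions on vertices.
\<close>

record 'u graph_arrow =
  src :: "'u pair_pre_digraph"
  fn :: "'u \<Rightarrow> 'u"
  tgt :: "'u pair_pre_digraph"

definition graph_homs :: "'u pair_pre_digraph \<Rightarrow> 'u pair_pre_digraph \<Rightarrow> 'u graph_arrow set" where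
  "graph_homs A B = {\<lparr>src = A, fn = h, tgt = B\<rparr> | h.
     h \<in> pverts A \<rightarrow>\<^sub>E pverts B \<and> (\<forall>(x, y) \<in> parcs A. (h x, h y) \<in> parcs B)}"

definition graph_comp :: "'u graph_arrow \<Rightarrow> 'u graph_arrow \<Rightarrow> 'u graph_arrow" where
  "graph_comp g f = \<lparr>src = src f, fn = compose (pverts (src f)) (fn g) (fn f), tgt = tgt g\<rparr>"

definition Graph :: "'u set set \<Rightarrow> ('u pair_pre_digraph, 'u graph_arrow) category" where
  "Graph S =
    (let Gs = {G. pair_bidirected_digraph G \<and> pverts G \<in> S} in
     \<lparr>Obj = Gs,
      Arr = (\<Union>A\<in>Gs. \<Union>B\<in>Gs. graph_homs A B),
      Dom = src,
      Cod = tgt,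
      Ident = (\<lambda>A. \<lparr>src = A, fn = (\<lambda>x\<in>pverts A. x), tgt = A\<rparr>),
      Comp = graph_comp\<rparr>)"


datatype subdiv_vertex = Branch nat | Subdiv nat nat nat

text \<open>
  For \<open>i < j\<close>, the subdivided edge between \<open>i\<close> and \<open>j\<close> is the path
  \<open>path_vertex p i j 0, \<dots>, path_vertex p i j (p + 1)\<close>, whose ends are the
  branch vertices \<open>i\<close> and \<open>j\<close>.
\<close>

definition path_vertex :: "nat \<Rightarrow> nat \<Rightarrow> nat \<Rightarrow> nat \<Rightarrow> subdiv_vertex" where
  "path_vertex p i j k = (if k = 0 then Branch i else if k = p + 1 then Branch j else Subdiv i j k)"

definition subdivided_clique :: "nat \<Rightarrow> nat \<Rightarrow> subdiv_vertex pair_pre_digraph" where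
  "subdivided_clique n p =
    (let E = {(path_vertex p i j k, path_vertex p i j (Suc k)) | i j k. i < j \<and> j < n \<and> k \<le> p} in
     \<lparr>pverts = {Branch i | i. i < n} \<union> {Subdiv i j k | i j k. i < j \<and> j < n \<and> 1 \<le> k \<and> k \<le> p},
      parcs = E \<union> E\<inverse>\<rparr>)"

text \<open>
  A copy with vertices in the universe \<^typ>\<open>'u\<close>; the chosen function is an injection
  whenever \<^typ>\<open>'u\<close> is infinite.
\<close>

definition subdivK :: "nat \<Rightarrow> nat \<Rightarrow> 'u pair_pre_digraph" where
  "subdivK n p =
    (let e = (SOME e :: subdiv_vertex \<Rightarrow> 'u. inj e) in
     \<lparr>pverts = e ` pverts (subdivided_clique n p),
      parcs = map_prod e e ` parcs (subdivided_clique n p)\<rparr>)"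

definition Cli :: "nat \<Rightarrow> 'u pair_pre_digraph set" where
  "Cli p = {subdivK n p | n. 1 \<le> n}"

definition monotone_class :: "'u pair_pre_digraph set \<Rightarrow> bool" where
  "monotone_class \<Delta> \<longleftrightarrow>
    (\<forall>G\<in>\<Delta>. \<forall>H. pair_graph H \<and> subgraph (with_proj H) (with_proj G) \<longrightarrow> H \<in> \<Delta>)"

definition somewhere_dense :: "'u pair_pre_digraph set \<Rightarrow> bool" where
  "somewhere_dense \<Delta> \<longleftrightarrow>
    (\<exists>p. \<forall>n\<ge>1. \<exists>G\<in>\<Delta>. \<exists>H. subgraph (with_proj H) (with_proj G) \<and>
      digraph_iso (with_proj (subdivided_clique n p)) (with_proj H))"

definition nowhere_dense :: "'u pair_pre_digraph set \<Rightarrow> bool" where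
  "nowhere_dense \<Delta> \<longleftrightarrow> \<not> somewhere_dense \<Delta>"

definition classifies ::
  "'u set set \<Rightarrow> ('u pair_pre_digraph, 'u graph_arrow) comonad_data
    \<Rightarrow> 'u pair_pre_digraph set \<Rightarrow> bool" where
  "classifies S C \<Delta> \<longleftrightarrow>
    (\<forall>X. pair_graph X \<longrightarrow> (X \<in> \<Delta> \<longleftrightarrow> (\<exists>\<alpha>. coalgebra (Graph S) C X \<alpha>)))"


definition clique_homs :: "nat \<Rightarrow> 'u pair_pre_digraph \<Rightarrow> 'u graph_arrow set" where
  "clique_homs p B = (\<Union>A\<in>Cli p. graph_homs A B)"

text \<open>
  The disjoint union \<open>\<Coprod>\<^bsub>A\<^esub> \<Coprod>\<^bsub>f: A \<rightarrow> B\<^esub> A\<close> has as vertices the pairs \<open>(f, x)\<close> with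
  \<open>x\<close> a vertex of the source of \<open>f\<close>. These pairs are moved back into the universe \<^typ>\<open>'u\<close>
  along a chosen function. For \<open>B\<close> with small vertex set an injective one exists: cliques are
  finite and there are countably many of them, so there are no more pairs than elements of
  some infinite small set.
\<close>

definition summand_points :: "nat \<Rightarrow> 'u pair_pre_digraph \<Rightarrow> ('u graph_arrow \<times> 'u) set" where
  "summand_points p B = (SIGMA f : clique_homs p B. pverts (src f))"

definition tag :: "nat \<Rightarrow> 'u pair_pre_digraph \<Rightarrow> 'u graph_arrow \<times> 'u \<Rightarrow> 'u" where
  "tag p B = (SOME e. inj_on e (summand_points p B))"

definition clique_sum :: "nat \<Rightarrow> 'u pair_pre_digraph \<Rightarrow> 'u pair_pre_digraph" where
  "clique_sum p B =
    \<lparr>pverts = tag p B ` summand_points p B,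
     parcs = {(tag p B (f, x), tag p B (f, y)) | f x y. f \<in> clique_homs p B \<and> (x, y) \<in> parcs (src f)}\<rparr>"

definition inclusion :: "nat \<Rightarrow> 'u graph_arrow \<Rightarrow> 'u graph_arrow" where
  "inclusion p f =
    \<lparr>src = src f, fn = (\<lambda>x\<in>pverts (src f). tag p (tgt f) (f, x)), tgt = clique_sum p (tgt f)\<rparr>"

text \<open>
  The arrow \<open>[k f]\<^sub>f\<close> from \<^term>\<open>clique_sum p B\<close> to \<^term>\<open>Y\<close> whose composite with each
  \<^term>\<open>inclusion p f\<close> is \<^term>\<open>k f\<close>.
\<close>

definition copair ::
  "nat \<Rightarrow> 'u pair_pre_digraph \<Rightarrow> 'u pair_pre_digraph
    \<Rightarrow> ('u graph_arrow \<Rightarrow> 'u graph_arrow) \<Rightarrow> 'u graph_arrow" where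
  "copair p B Y k =
    \<lparr>src = clique_sum p B,
     fn = (\<lambda>z\<in>pverts (clique_sum p B).
       case the_inv_into (summand_points p B) (tag p B) z of (f, x) \<Rightarrow> fn (k f) x),
     tgt = Y\<rparr>"

definition density_comonad ::
  "nat \<Rightarrow> ('u pair_pre_digraph, 'u graph_arrow) comonad_data" where
  "density_comonad p =
    \<lparr>Fobj = clique_sum p,
     Farr = (\<lambda>h. copair p (src h) (clique_sum p (tgt h)) (\<lambda>f. inclusion p (graph_comp h f))),
     Counit = (\<lambda>B. copair p B B (\<lambda>f. f)),
     Comult = (\<lambda>B. copair p B (clique_sum p (clique_sum p B)) (\<lambda>f. inclusion p (inclusion p f)))\<rparr>"

end

theory Submission
  imports Defs
begin

text \<open>
  For a discrete category \<open>K\<close> of objects, a comonad morphism from the density comonad of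
  \<open>K\<close> to \<open>C\<close> amounts to a choice of a \<open>C\<close>-coalgebra on each object of
  \<open>K\<close>: a morphism \<open>l\<close> gives the coalgebras \<open>l\<^sub>A \<circ> \<iota>\<^bsub>id\<^esub>\<close>, and
  coalgebras \<open>\<alpha>\<^sub>A\<close> give the \<open>l\<close> with
  \<open>l\<^sub>B \<circ> \<iota>\<^sub>f = C f \<circ> \<alpha>\<^sub>A\<close>. Hence there is a morphism from
  the density comonad of the \<open>p\<close>-subdivided cliques to \<open>C\<close> iff all of these cliques
  are in the class \<open>\<Delta>\<close>. By monotonicity of \<open>\<Delta>\<close> and transport of coalgebras
  along isomorphisms, this says that \<open>p\<close> witnesses that \<open>\<Delta>\<close> is somewhere dense.
\<close>

section \<open>Density comonads of discrete categories\<close>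

context category
begin

lemma hom_Dom: "f \<in> hom \<X> A B \<Longrightarrow> Dom \<X> f = A"
  and hom_Cod: "f \<in> hom \<X> A B \<Longrightarrow> Cod \<X> f = B"
  by (simp_all add: hom_def)

lemma hom_Obj_Dom: "f \<in> hom \<X> A B \<Longrightarrow> A \<in> Obj \<X>"
  and hom_Obj_Cod: "f \<in> hom \<X> A B \<Longrightarrow> B \<in> Obj \<X>"
  by (auto simp: hom_def Dom_in_Obj Cod_in_Obj)

end

text \<open>The structure map is conjugated by the isomorphism, and naturality of counit and
  comultiplication at \<open>h\<close> reduces both laws to those of \<open>\<alpha>\<close>. This
  is needed because a clique in \<open>Cli p\<close> and a copy of it found inside a member of
  \<open>\<Delta>\<close> are only isomorphic.\<close>

lemma (in comonad) coalgebra_transport: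
  assumes "coalgebra \<X> T A \<alpha>" and h: "h \<in> hom \<X> A B" and k: "k \<in> hom \<X> B A"
    and hk: "h \<odot> k = Ident \<X> B" and kh: "k \<odot> h = Ident \<X> A"
  shows "coalgebra \<X> T B (Farr T h \<odot> \<alpha> \<odot> k)"
proof -
  have A: "A \<in> Obj \<X>" and a: "\<alpha> \<in> hom \<X> A (Fobj T A)"
    and counit: "Counit T A \<odot> \<alpha> = Ident \<X> A"
    and comult: "Comult T A \<odot> \<alpha> = Farr T \<alpha> \<odot> \<alpha>"
    using assms(1) by (auto simp: coalgebra_def)
  have B: "B \<in> Obj \<X>" using h by (rule hom_Obj_Cod)
  note Th = Farr_in_hom[OF h] and Ta = Farr_in_hom[OF a] and Tk = Farr_in_hom[OF k]
  note TTh = Farr_in_hom[OF Th]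
  note Tha = Comp_in_hom[OF a Th] and ak = Comp_in_hom[OF k a]
  note beta = Comp_in_hom[OF k Tha] and TTha = Comp_in_hom[OF Ta TTh]
  \<comment> \<open>\<open>\<odot>\<close> associates to the left, whereas the computations below
    treat \<open>\<alpha> \<odot> k\<close> as a single arrow.\<close>
  have assoc: "Farr T h \<odot> \<alpha> \<odot> k = Farr T h \<odot> (\<alpha> \<odot> k)"
    by (rule Comp_assoc[OF k a Th])
  have "Counit T B \<odot> (Farr T h \<odot> \<alpha> \<odot> k) = (Counit T B \<odot> Farr T h) \<odot> (\<alpha> \<odot> k)"
    unfolding assoc by (rule Comp_assoc[OF ak Th Counit_in_hom[OF B], symmetric])
  also have "\<dots> = h \<odot> (Counit T A \<odot> (\<alpha> \<odot> k))"
    unfolding Counit_natural[OF h] by (rule Comp_assoc[OF ak Counit_in_hom[OF A] h])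
  also have "Counit T A \<odot> (\<alpha> \<odot> k) = k"
    using Comp_assoc[OF k a Counit_in_hom[OF A]] counit Ident_Comp[OF k] by simp
  finally have 1: "Counit T B \<odot> (Farr T h \<odot> \<alpha> \<odot> k) = Ident \<X> B"
    using hk by simp
  have "Comult T B \<odot> (Farr T h \<odot> \<alpha> \<odot> k) = (Comult T B \<odot> Farr T h) \<odot> (\<alpha> \<odot> k)"
    unfolding assoc by (rule Comp_assoc[OF ak Th Comult_in_hom[OF B], symmetric])
  also have "\<dots> = Farr T (Farr T h) \<odot> (Comult T A \<odot> (\<alpha> \<odot> k))"
    unfolding Comult_natural[OF h] by (rule Comp_assoc[OF ak Comult_in_hom[OF A] TTh])
  also have "Comult T A \<odot> (\<alpha> \<odot> k) = Farr T \<alpha> \<odot> (\<alpha> \<odot> k)"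
    using Comp_assoc[OF k a Comult_in_hom[OF A]] Comp_assoc[OF k a Ta] comult by simp
  also have "Farr T (Farr T h) \<odot> (Farr T \<alpha> \<odot> (\<alpha> \<odot> k)) = Farr T (Farr T h \<odot> \<alpha>) \<odot> (\<alpha> \<odot> k)"
    unfolding Farr_Comp[OF a Th] by (rule Comp_assoc[OF ak Ta TTh, symmetric])
  \<comment> \<open>Inserting the identity \<open>k \<odot> h\<close> makes the new structure map
    appear under \<open>Farr T\<close>. Functoriality then splits off \<open>Farr T h\<close>, which
    completes the second copy of the structure map.\<close>
  also have "Farr T (Farr T h \<odot> \<alpha>) = Farr T ((Farr T h \<odot> \<alpha> \<odot> k) \<odot> h)"
    using Comp_assoc[OF h k Tha] kh Comp_Ident[OF Tha] by simp
  also have "\<dots> \<odot> (\<alpha> \<odot> k)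
      = Farr T (Farr T h \<odot> \<alpha> \<odot> k) \<odot> (Farr T h \<odot> (\<alpha> \<odot> k))"
    unfolding Farr_Comp[OF h beta] by (rule Comp_assoc[OF ak Th Farr_in_hom[OF beta]])
  finally have 2: "Comult T B \<odot> (Farr T h \<odot> \<alpha> \<odot> k)
      = Farr T (Farr T h \<odot> \<alpha> \<odot> k) \<odot> (Farr T h \<odot> \<alpha> \<odot> k)"
    unfolding assoc .
  show ?thesis
    unfolding coalgebra_def using B beta 1 2 by blast
qed

text \<open>
  \<open>coprod B\<close> stands for the coproduct of the domains of all arrows from objects of
  \<open>K\<close> to \<open>B\<close>, and \<open>incl f\<close> for the coprojection of the summand indexed by
  \<open>f\<close>. The universal property is stated by \<open>cop\<close> and by the joint epimorphy
  \<open>coprod_ext\<close>.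
\<close>

locale discrete_density = category \<X> for \<X> :: "('o, 'm) category" (structure) +
  fixes K :: "'o set"
    and coprod :: "'o \<Rightarrow> 'o"
    and incl :: "'m \<Rightarrow> 'm"
    and cop :: "'o \<Rightarrow> 'o \<Rightarrow> ('m \<Rightarrow> 'm) \<Rightarrow> 'm"
  assumes coprod_in_Obj: "B \<in> Obj \<X> \<Longrightarrow> coprod B \<in> Obj \<X>"
    and incl_in_hom: "\<lbrakk>A \<in> K; f \<in> hom \<X> A B\<rbrakk> \<Longrightarrow> incl f \<in> hom \<X> A (coprod B)"
    and cop_in_hom: "\<lbrakk>B \<in> Obj \<X>; Y \<in> Obj \<X>;
        \<And>A f. \<lbrakk>A \<in> K; f \<in> hom \<X> A B\<rbrakk> \<Longrightarrow> k f \<in> hom \<X> A Y\<rbrakk>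
      \<Longrightarrow> cop B Y k \<in> hom \<X> (coprod B) Y"
    and cop_incl: "\<lbrakk>Y \<in> Obj \<X>;
        \<And>A f. \<lbrakk>A \<in> K; f \<in> hom \<X> A B\<rbrakk> \<Longrightarrow> k f \<in> hom \<X> A Y;
        A \<in> K; f \<in> hom \<X> A B\<rbrakk>
      \<Longrightarrow> cop B Y k \<odot> incl f = k f"
    and coprod_ext: "\<lbrakk>g \<in> hom \<X> (coprod B) Y; h \<in> hom \<X> (coprod B) Y; B \<in> Obj \<X>;
        \<And>A f. \<lbrakk>A \<in> K; f \<in> hom \<X> A B\<rbrakk> \<Longrightarrow> g \<odot> incl f = h \<odot> incl f\<rbrakk>
      \<Longrightarrow> g = h"
begin

section \<open>The density comonad of \<open>K\<close> and the comonad morphisms out of it\<close>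

definition density :: "('o, 'm) comonad_data" where
  "density =
    \<lparr>Fobj = coprod,
     Farr = (\<lambda>h. cop (Dom \<X> h) (coprod (Cod \<X> h)) (\<lambda>f. incl (h \<odot> f))),
     Counit = (\<lambda>B. cop B B (\<lambda>f. f)),
     Comult = (\<lambda>B. cop B (coprod (coprod B)) (\<lambda>f. incl (incl f)))\<rparr>"

lemma Fobj_density [simp]: "Fobj density = coprod"
  by (simp add: density_def)

text \<open>Both claims are the universal property of \<open>coprod B\<close> for the family
  \<open>incl (h \<odot> f)\<close>. Together with the next lemma they replace unfolding
  \<open>density\<close> in the rest of the locale.\<close>

lemma
  assumes h: "h \<in> hom \<X> B B'"
  shows Farr_density_in_hom: "Farr density h \<in> hom \<X> (coprod B) (coprod B')"
    and Farr_density_incl: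
      "\<lbrakk>A \<in> K; f \<in> hom \<X> A B\<rbrakk> \<Longrightarrow> Farr density h \<odot> incl f = incl (h \<odot> f)"
proof -
  have k: "incl (h \<odot> f) \<in> hom \<X> A (coprod B')" if "A \<in> K" "f \<in> hom \<X> A B" for A f
    using that h by (blast intro: incl_in_hom Comp_in_hom)
  note B = hom_Obj_Dom[OF h] and B' = coprod_in_Obj[OF hom_Obj_Cod[OF h]]
  show "Farr density h \<in> hom \<X> (coprod B) (coprod B')"
    using cop_in_hom[OF B B' k] by (simp add: density_def hom_Dom[OF h] hom_Cod[OF h])
  show "Farr density h \<odot> incl f = incl (h \<odot> f)" if "A \<in> K" "f \<in> hom \<X> A B" for A f
    using cop_incl[where k = "\<lambda>f. incl (h \<odot> f)", OF B' k that]
    by (simp add: density_def hom_Dom[OF h] hom_Cod[OF h])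
qed

lemma
  assumes B: "B \<in> Obj \<X>"
  shows Counit_density_in_hom: "Counit density B \<in> hom \<X> (coprod B) B"
    and Counit_density_incl:
      "\<lbrakk>A \<in> K; f \<in> hom \<X> A B\<rbrakk> \<Longrightarrow> Counit density B \<odot> incl f = f"
    and Comult_density_in_hom: "Comult density B \<in> hom \<X> (coprod B) (coprod (coprod B))"
    and Comult_density_incl:
      "\<lbrakk>A \<in> K; f \<in> hom \<X> A B\<rbrakk> \<Longrightarrow> Comult density B \<odot> incl f = incl (incl f)"
  using cop_in_hom[OF B B, of "\<lambda>f. f"] cop_incl[OF B, of B "\<lambda>f. f"]
    cop_in_hom[OF B coprod_in_Obj[OF coprod_in_Obj[OF B]], of "\<lambda>f. incl (incl f)"]
    cop_incl[OF coprod_in_Obj[OF coprod_in_Obj[OF B]], of B "\<lambda>f. incl (incl f)"]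
    incl_in_hom
  by (auto simp: density_def)

lemmas density_in_hom = Farr_density_in_hom Counit_density_in_hom Comult_density_in_hom

text \<open>This brings a coprojection next to the arrow out of its coproduct, where the computation
  rules for \<open>incl\<close> apply.\<close>

lemma Comp_incl:
  assumes "g \<in> hom \<X> (coprod B) Y" "h \<in> hom \<X> Y Z" "A \<in> K" "f \<in> hom \<X> A B"
  shows "(h \<odot> g) \<odot> incl f = h \<odot> (g \<odot> incl f)"
  using Comp_assoc[OF incl_in_hom[OF assms(3,4)] assms(1,2)] .

text \<open>Each equational law compares two arrows out of \<open>coprod A\<close>, so by
  \<open>coprod_ext\<close> it may be tested on coprojections. There the rules for
  \<open>incl\<close> evaluate both sides; for coassociativity, for instance, both become
  \<open>incl (incl (incl u))\<close>.\<close>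

lemma comonad_density: "comonad \<X> density"
proof
  fix A assume "A \<in> Obj \<X>"
  then show "Fobj density A \<in> Obj \<X>" by (simp add: coprod_in_Obj)
next
  fix f A B assume "f \<in> hom \<X> A B"
  then show "Farr density f \<in> hom \<X> (Fobj density A) (Fobj density B)"
    by (simp add: Farr_density_in_hom)
next
  fix A assume A: "A \<in> Obj \<X>"
  note id = Ident_in_hom[OF A] and idS = Ident_in_hom[OF coprod_in_Obj[OF A]]
  show "Farr density (Ident \<X> A) = Ident \<X> (Fobj density A)"
  proof (rule coprod_ext[OF _ _ A])
    show "Farr density (Ident \<X> A) \<in> hom \<X> (coprod A) (coprod A)"
      by (rule Farr_density_in_hom[OF id])
    show "Ident \<X> (Fobj density A) \<in> hom \<X> (coprod A) (coprod A)"
      using idS by simp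
    fix P u assume u: "P \<in> K" "u \<in> hom \<X> P A"
    show "Farr density (Ident \<X> A) \<odot> incl u = Ident \<X> (Fobj density A) \<odot> incl u"
      using Farr_density_incl[OF id u] Ident_Comp[OF u(2)] Ident_Comp[OF incl_in_hom[OF u]]
      by simp
  qed
next
  fix f A B g D assume f: "f \<in> hom \<X> A B" and g: "g \<in> hom \<X> B D"
  show "Farr density (g \<odot> f) = Farr density g \<odot> Farr density f"
  proof (rule coprod_ext[OF _ _ hom_Obj_Dom[OF f]])
    show "Farr density (g \<odot> f) \<in> hom \<X> (coprod A) (coprod D)"
      "Farr density g \<odot> Farr density f \<in> hom \<X> (coprod A) (coprod D)"
      using f g by (blast intro: density_in_hom Comp_in_hom)+
    fix P u assume u: "P \<in> K" "u \<in> hom \<X> P A"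
    show "Farr density (g \<odot> f) \<odot> incl u = Farr density g \<odot> Farr density f \<odot> incl u"
      using Farr_density_incl[OF Comp_in_hom[OF f g] u] Farr_density_incl[OF f u]
        Farr_density_incl[OF g u(1) Comp_in_hom[OF u(2) f]] Comp_assoc[OF u(2) f g]
        Comp_incl[OF Farr_density_in_hom[OF f] Farr_density_in_hom[OF g] u]
      by simp
  qed
next
  fix A assume "A \<in> Obj \<X>"
  then show "Counit density A \<in> hom \<X> (Fobj density A) A"
    by (simp add: Counit_density_in_hom)
next
  fix f A B assume f: "f \<in> hom \<X> A B"
  note A = hom_Obj_Dom[OF f] and B = hom_Obj_Cod[OF f]
  show "Counit density B \<odot> Farr density f = f \<odot> Counit density A"
  proof (rule coprod_ext[OF _ _ A])
    show "Counit density B \<odot> Farr density f \<in> hom \<X> (coprod A) B"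
      "f \<odot> Counit density A \<in> hom \<X> (coprod A) B"
      using f A B by (blast intro: density_in_hom Comp_in_hom)+
    fix P u assume u: "P \<in> K" "u \<in> hom \<X> P A"
    show "Counit density B \<odot> Farr density f \<odot> incl u = f \<odot> Counit density A \<odot> incl u"
      using Comp_incl[OF Farr_density_in_hom[OF f] Counit_density_in_hom[OF B] u]
        Comp_incl[OF Counit_density_in_hom[OF A] f u] Farr_density_incl[OF f u]
        Counit_density_incl[OF A u] Counit_density_incl[OF B u(1) Comp_in_hom[OF u(2) f]]
      by simp
  qed
next
  fix A assume "A \<in> Obj \<X>"
  then show "Comult density A \<in> hom \<X> (Fobj density A) (Fobj density (Fobj density A))"
    by (simp add: Comult_density_in_hom)
next
  fix f A B assume f: "f \<in> hom \<X> A B"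
  note A = hom_Obj_Dom[OF f] and B = hom_Obj_Cod[OF f]
  note Df = Farr_density_in_hom[OF f]
  show "Comult density B \<odot> Farr density f = Farr density (Farr density f) \<odot> Comult density A"
  proof (rule coprod_ext[OF _ _ A])
    show "Comult density B \<odot> Farr density f \<in> hom \<X> (coprod A) (coprod (coprod B))"
      "Farr density (Farr density f) \<odot> Comult density A \<in> hom \<X> (coprod A) (coprod (coprod B))"
      using f A B by (blast intro: density_in_hom Comp_in_hom)+
    fix P u assume u: "P \<in> K" "u \<in> hom \<X> P A"
    show "Comult density B \<odot> Farr density f \<odot> incl u
        = Farr density (Farr density f) \<odot> Comult density A \<odot> incl u"
      using Comp_incl[OF Df Comult_density_in_hom[OF B] u]
        Comp_incl[OF Comult_density_in_hom[OF A] Farr_density_in_hom[OF Df] u]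
        Farr_density_incl[OF f u] Comult_density_incl[OF A u]
        Comult_density_incl[OF B u(1) Comp_in_hom[OF u(2) f]]
        Farr_density_incl[OF Df u(1) incl_in_hom[OF u]]
      by simp
  qed
next
  fix A assume A: "A \<in> Obj \<X>"
  note SA = coprod_in_Obj[OF A]
  note \<epsilon> = Counit_density_in_hom[OF A] and \<delta> = Comult_density_in_hom[OF A]
  show "Counit density (Fobj density A) \<odot> Comult density A = Ident \<X> (Fobj density A)"
  proof (rule coprod_ext[OF _ _ A])
    show "Counit density (Fobj density A) \<odot> Comult density A \<in> hom \<X> (coprod A) (coprod A)"
      "Ident \<X> (Fobj density A) \<in> hom \<X> (coprod A) (coprod A)"
      using A SA by (auto intro: density_in_hom Comp_in_hom Ident_in_hom)
    fix P u assume u: "P \<in> K" "u \<in> hom \<X> P A"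
    \<comment> \<open>The coprojection \<open>incl u\<close> is itself an arrow from
      \<open>P\<close> in \<open>K\<close>, so it indexes a summand of
      \<open>coprod (coprod A)\<close> and the same rules apply one level up.\<close>
    show "Counit density (Fobj density A) \<odot> Comult density A \<odot> incl u
        = Ident \<X> (Fobj density A) \<odot> incl u"
      using Comp_incl[OF \<delta> Counit_density_in_hom[OF SA] u] Comult_density_incl[OF A u]
        Counit_density_incl[OF SA u(1) incl_in_hom[OF u]] Ident_Comp[OF incl_in_hom[OF u]]
      by simp
  qed
  show "Farr density (Counit density A) \<odot> Comult density A = Ident \<X> (Fobj density A)"
  proof (rule coprod_ext[OF _ _ A])
    show "Farr density (Counit density A) \<odot> Comult density A \<in> hom \<X> (coprod A) (coprod A)"
      "Ident \<X> (Fobj density A) \<in> hom \<X> (coprod A) (coprod A)"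
      using A SA by (auto intro: density_in_hom Comp_in_hom Ident_in_hom)
    fix P u assume u: "P \<in> K" "u \<in> hom \<X> P A"
    show "Farr density (Counit density A) \<odot> Comult density A \<odot> incl u
        = Ident \<X> (Fobj density A) \<odot> incl u"
      using Comp_incl[OF \<delta> Farr_density_in_hom[OF \<epsilon>] u] Comult_density_incl[OF A u]
        Farr_density_incl[OF \<epsilon> u(1) incl_in_hom[OF u]] Counit_density_incl[OF A u]
        Ident_Comp[OF incl_in_hom[OF u]]
      by simp
  qed
  show "Comult density (Fobj density A) \<odot> Comult density A
      = Farr density (Comult density A) \<odot> Comult density A"
  proof (rule coprod_ext[OF _ _ A])
    let ?SSS = "coprod (coprod (coprod A))"
    show "Comult density (Fobj density A) \<odot> Comult density A \<in> hom \<X> (coprod A) ?SSS"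
      "Farr density (Comult density A) \<odot> Comult density A \<in> hom \<X> (coprod A) ?SSS"
      using A SA by (auto intro: density_in_hom Comp_in_hom)
    fix P u assume u: "P \<in> K" "u \<in> hom \<X> P A"
    show "Comult density (Fobj density A) \<odot> Comult density A \<odot> incl u
        = Farr density (Comult density A) \<odot> Comult density A \<odot> incl u"
      using Comp_incl[OF \<delta> Farr_density_in_hom[OF \<delta>] u] Comult_density_incl[OF A u]
        Comp_incl[OF \<delta> Comult_density_in_hom[OF SA] u]
        Farr_density_incl[OF \<delta> u(1) incl_in_hom[OF u]]
        Comult_density_incl[OF SA u(1) incl_in_hom[OF u]]
      by simp
  qed
qed

text \<open>All conditions are tested on coprojections. Naturality is then functoriality of
  \<open>C\<close>; the counit and comultiplication conditions follow from naturality in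
  \<open>C\<close> at \<open>u\<close> and the corresponding coalgebra law of
  \<open>\<alpha> P\<close>. The family sees only the arrow \<open>f\<close>, hence it recovers the
  clique as \<open>Dom \<X> f\<close>.\<close>

lemma comonad_morphism_of_coalgebras:
  assumes "comonad \<X> C" and K: "K \<subseteq> Obj \<X>"
    and coalg: "\<And>A. A \<in> K \<Longrightarrow> coalgebra \<X> C A (\<alpha> A)"
  shows "comonad_morphism \<X> density C
    (\<lambda>B. cop B (Fobj C B) (\<lambda>f. Farr C f \<odot> \<alpha> (Dom \<X> f)))"
    (is "comonad_morphism _ _ _ ?l")
proof -
  interpret C: comonad \<X> C by fact
  interpret D: comonad \<X> density by (rule comonad_density)
  have \<alpha>: "\<alpha> A \<in> hom \<X> A (Fobj C A)" and \<alpha>_counit: "Counit C A \<odot> \<alpha> A = Ident \<X> A"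
    and \<alpha>_comult: "Comult C A \<odot> \<alpha> A = Farr C (\<alpha> A) \<odot> \<alpha> A" if "A \<in> K" for A
    using coalg[OF that] by (auto simp: coalgebra_def)
  have k: "Farr C f \<odot> \<alpha> (Dom \<X> f) \<in> hom \<X> A (Fobj C B)"
    if "A \<in> K" "f \<in> hom \<X> A B" for A B f
    using Comp_in_hom[OF \<alpha>[OF that(1)] C.Farr_in_hom[OF that(2)]] by (simp add: hom_Dom[OF that(2)])
  have l_hom: "?l B \<in> hom \<X> (coprod B) (Fobj C B)" if "B \<in> Obj \<X>" for B
    using that by (intro cop_in_hom k C.Fobj_in_Obj)
  have l_incl: "?l B \<odot> incl f = Farr C f \<odot> \<alpha> A" if f: "A \<in> K" "f \<in> hom \<X> A B" for A B f
    using cop_incl[where k = "\<lambda>f. Farr C f \<odot> \<alpha> (Dom \<X> f)", OF C.Fobj_in_Obj[OF hom_Obj_Cod[OF f(2)]] k f]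
    by (simp add: hom_Dom[OF f(2)])
  show ?thesis
  proof
    fix A assume A: "A \<in> Obj \<X>"
    note CA = C.Fobj_in_Obj[OF A] and \<epsilon> = C.Counit_in_hom[OF A] and \<delta> = C.Comult_in_hom[OF A]
      and l = l_hom[OF A] and lC = l_hom[OF C.Fobj_in_Obj[OF A]]
      and D\<delta> = Comult_density_in_hom[OF A]
    note Dl = Farr_density_in_hom[OF l]
    show "?l A \<in> hom \<X> (Fobj density A) (Fobj C A)"
      using l_hom[OF A] by simp
    show "Counit C A \<odot> ?l A = Counit density A"
    proof (rule coprod_ext[OF _ _ A])
      show "Counit C A \<odot> ?l A \<in> hom \<X> (coprod A) A" by (rule Comp_in_hom[OF l \<epsilon>])
      show "Counit density A \<in> hom \<X> (coprod A) A" by (rule Counit_density_in_hom[OF A])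
      fix P u assume u: "P \<in> K" "u \<in> hom \<X> P A"
      note P = hom_Obj_Dom[OF u(2)]
      have "Counit C A \<odot> ?l A \<odot> incl u = Counit C A \<odot> (Farr C u \<odot> \<alpha> P)"
        using Comp_incl[OF l \<epsilon> u] l_incl[OF u] by simp
      also have "\<dots> = u \<odot> (Counit C P \<odot> \<alpha> P)"
        using Comp_assoc[OF \<alpha>[OF u(1)] C.Farr_in_hom[OF u(2)] \<epsilon>] C.Counit_natural[OF u(2)]
          Comp_assoc[OF \<alpha>[OF u(1)] C.Counit_in_hom[OF P] u(2)] by simp
      also have "\<dots> = Counit density A \<odot> incl u"
        using \<alpha>_counit[OF u(1)] Comp_Ident[OF u(2)] Counit_density_incl[OF A u] by simp
      finally show "Counit C A \<odot> ?l A \<odot> incl u = Counit density A \<odot> incl u" .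
    qed
    show "Comult C A \<odot> ?l A = ?l (Fobj C A) \<odot> Farr density (?l A) \<odot> Comult density A"
    proof (rule coprod_ext[OF _ _ A])
      note lD = Comp_in_hom[OF Dl lC]
      show "Comult C A \<odot> ?l A \<in> hom \<X> (coprod A) (Fobj C (Fobj C A))"
        by (rule Comp_in_hom[OF l \<delta>])
      show "?l (Fobj C A) \<odot> Farr density (?l A) \<odot> Comult density A
          \<in> hom \<X> (coprod A) (Fobj C (Fobj C A))"
        by (rule Comp_in_hom[OF D\<delta> lD])
      fix P u assume u: "P \<in> K" "u \<in> hom \<X> P A"
      note P = hom_Obj_Dom[OF u(2)]
      note Cu = C.Farr_in_hom[OF u(2)] and aP = \<alpha>[OF u(1)]
      note CCu = C.Farr_in_hom[OF Cu] and CaP = C.Farr_in_hom[OF aP]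
      note Cua = Comp_in_hom[OF aP Cu]
      have "Comult C A \<odot> ?l A \<odot> incl u = Comult C A \<odot> (Farr C u \<odot> \<alpha> P)"
        using Comp_incl[OF l \<delta> u] l_incl[OF u] by simp
      also have "\<dots> = Farr C (Farr C u) \<odot> (Comult C P \<odot> \<alpha> P)"
        using Comp_assoc[OF aP Cu \<delta>] C.Comult_natural[OF u(2)]
          Comp_assoc[OF aP C.Comult_in_hom[OF P] CCu] by simp
      also have "\<dots> = Farr C (Farr C u \<odot> \<alpha> P) \<odot> \<alpha> P"
        using \<alpha>_comult[OF u(1)] Comp_assoc[OF aP CaP CCu] C.Farr_Comp[OF aP Cu] by simp
      \<comment> \<open>\<open>Farr C u \<odot> \<alpha> P\<close> is an arrow from \<open>P\<close>
        to \<open>Fobj C A\<close> and so indexes a summand of \<open>coprod (Fobj C A)\<close>. The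
        defining equation of \<open>?l\<close> is read backwards at that index.\<close>
      also have "\<dots> = ?l (Fobj C A) \<odot> incl (?l A \<odot> incl u)"
        using l_incl[OF u] l_incl[OF u(1) Cua] by simp
      also have "\<dots> = ?l (Fobj C A) \<odot> (Farr density (?l A) \<odot> incl (incl u))"
        using Farr_density_incl[OF l u(1) incl_in_hom[OF u]] by simp
      also have "\<dots> = (?l (Fobj C A) \<odot> Farr density (?l A)) \<odot> (Comult density A \<odot> incl u)"
        using Comp_incl[OF Dl lC u(1) incl_in_hom[OF u]] Comult_density_incl[OF A u] by simp
      also have "\<dots> = ?l (Fobj C A) \<odot> Farr density (?l A) \<odot> Comult density A \<odot> incl u"
        using Comp_incl[OF D\<delta> lD u] by simp
      finally show "Comult C A \<odot> ?l A \<odot> incl u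
        = ?l (Fobj C A) \<odot> Farr density (?l A) \<odot> Comult density A \<odot> incl u" .
    qed
  next
    fix f A B assume f: "f \<in> hom \<X> A B"
    note A = hom_Obj_Dom[OF f] and B = hom_Obj_Cod[OF f]
    note Df = Farr_density_in_hom[OF f] and Cf = C.Farr_in_hom[OF f]
      and lA = l_hom[OF A] and lB = l_hom[OF B]
    show "?l B \<odot> Farr density f = Farr C f \<odot> ?l A"
    proof (rule coprod_ext[OF _ _ A])
      show "?l B \<odot> Farr density f \<in> hom \<X> (coprod A) (Fobj C B)" by (rule Comp_in_hom[OF Df lB])
      show "Farr C f \<odot> ?l A \<in> hom \<X> (coprod A) (Fobj C B)" by (rule Comp_in_hom[OF lA Cf])
      fix P u assume u: "P \<in> K" "u \<in> hom \<X> P A"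
      note Cu = C.Farr_in_hom[OF u(2)]
      have "?l B \<odot> Farr density f \<odot> incl u = ?l B \<odot> incl (f \<odot> u)"
        using Comp_incl[OF Df lB u] Farr_density_incl[OF f u] by simp
      also have "\<dots> = (Farr C f \<odot> Farr C u) \<odot> \<alpha> P"
        using l_incl[OF u(1) Comp_in_hom[OF u(2) f]] C.Farr_Comp[OF u(2) f] by simp
      also have "\<dots> = Farr C f \<odot> ?l A \<odot> incl u"
        using Comp_assoc[OF \<alpha>[OF u(1)] Cu Cf] Comp_incl[OF lA Cf u] l_incl[OF u] by simp
      finally show "?l B \<odot> Farr density f \<odot> incl u = Farr C f \<odot> ?l A \<odot> incl u" .
    qed
  qed
qed

text \<open>The coprojection indexed by the identity is a coalgebra for \<open>density\<close> on
  \<open>A\<close>, and a comonad morphism sends coalgebras of its source to coalgebras of its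
  target. The calculation below combines the two facts.\<close>

lemma coalgebra_of_comonad_morphism:
  assumes "comonad_morphism \<X> density C l" and A: "A \<in> K" "A \<in> Obj \<X>"
  shows "coalgebra \<X> C A (l A \<odot> incl (Ident \<X> A))"
proof -
  interpret l: comonad_morphism \<X> density C l by fact
  let ?\<iota> = "incl (Ident \<X> A)" and ?\<alpha> = "l A \<odot> incl (Ident \<X> A)"
  note id = A(1) Ident_in_hom[OF A(2)]
  note \<iota> = incl_in_hom[OF id]
  have lA: "l B \<in> hom \<X> (coprod B) (Fobj C B)" if "B \<in> Obj \<X>" for B
    using l.component_in_hom[OF that] by simp
  note CA = l.target.Fobj_in_Obj[OF A(2)] and D\<delta> = Comult_density_in_hom[OF A(2)]
  note lA = lA[OF A(2)] and lCA = lA[OF CA]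
  note \<alpha> = Comp_in_hom[OF \<iota> lA]
  note DlA = Farr_density_in_hom[OF lA]
  note lD = Comp_in_hom[OF DlA lCA]
  have "Counit C A \<odot> ?\<alpha> = (Counit C A \<odot> l A) \<odot> ?\<iota>"
    using Comp_incl[OF lA l.target.Counit_in_hom[OF A(2)] id] by simp
  also have "\<dots> = Ident \<X> A"
    using l.preserves_Counit[OF A(2)] Counit_density_incl[OF A(2) id] by simp
  finally have 1: "Counit C A \<odot> ?\<alpha> = Ident \<X> A" .
  have "Comult C A \<odot> ?\<alpha> = (Comult C A \<odot> l A) \<odot> ?\<iota>"
    using Comp_incl[OF lA l.target.Comult_in_hom[OF A(2)] id] by simp
  also have "\<dots> = (l (Fobj C A) \<odot> Farr density (l A)) \<odot> incl ?\<iota>"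
    using l.preserves_Comult[OF A(2)] Comp_incl[OF D\<delta> lD id] Comult_density_incl[OF A(2) id]
    by simp
  also have "\<dots> = l (Fobj C A) \<odot> incl ?\<alpha>"
    using Comp_incl[OF DlA lCA A(1) \<iota>] Farr_density_incl[OF lA A(1) \<iota>] by simp
  \<comment> \<open>Writing the index as \<open>?\<alpha>\<close> composed with the identity
    prepares for naturality of \<open>l\<close> at \<open>?\<alpha>\<close>.\<close>
  also have "incl ?\<alpha> = Farr density ?\<alpha> \<odot> ?\<iota>"
    using Farr_density_incl[OF \<alpha> id] Comp_Ident[OF \<alpha>] by simp
  also have "l (Fobj C A) \<odot> (Farr density ?\<alpha> \<odot> ?\<iota>) = (Farr C ?\<alpha> \<odot> l A) \<odot> ?\<iota>"
    using Comp_incl[OF Farr_density_in_hom[OF \<alpha>] lCA id] l.natural[OF \<alpha>] by simp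
  also have "\<dots> = Farr C ?\<alpha> \<odot> ?\<alpha>"
    using Comp_incl[OF lA l.target.Farr_in_hom[OF \<alpha>] id] .
  finally have 2: "Comult C A \<odot> ?\<alpha> = Farr C ?\<alpha> \<odot> ?\<alpha>" .
  show ?thesis
    unfolding coalgebra_def using A(2) \<alpha> 1 2 by blast
qed

theorem comonad_morphism_iff_coalgebras:
  assumes "comonad \<X> C" and "K \<subseteq> Obj \<X>"
  shows "(\<exists>l. comonad_morphism \<X> density C l) \<longleftrightarrow> (\<forall>A\<in>K. \<exists>\<alpha>. coalgebra \<X> C A \<alpha>)"
proof
  assume "\<exists>l. comonad_morphism \<X> density C l"
  then show "\<forall>A\<in>K. \<exists>\<alpha>. coalgebra \<X> C A \<alpha>"
    using coalgebra_of_comonad_morphism assms(2) by blast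
next
  assume "\<forall>A\<in>K. \<exists>\<alpha>. coalgebra \<X> C A \<alpha>"
  \<comment> \<open>One arbitrary coalgebra per object suffices: \<open>K\<close> is discrete, so
    the choices need not be compatible with each other.\<close>
  then obtain \<alpha> where "\<And>A. A \<in> K \<Longrightarrow> coalgebra \<X> C A (\<alpha> A)" by metis
  then show "\<exists>l. comonad_morphism \<X> density C l"
    using comonad_morphism_of_coalgebras[OF assms] by blast
qed

end

section \<open>The category of graphs has the density coproducts\<close>


lemma lepoll_UN_infinite:
  assumes "infinite M" "I \<lesssim> M" "\<And>i. i \<in> I \<Longrightarrow> A i \<lesssim> M"
  shows "(\<Union>i\<in>I. A i) \<lesssim> M"
  using assms card_of_UNION_ordLeq_infinite[of M I A] unfolding lepoll_def card_of_ordLeq by blast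

lemma lepoll_Sigma_infinite:
  assumes "infinite M" "I \<lesssim> M" "\<And>i. i \<in> I \<Longrightarrow> A i \<lesssim> M"
  shows "Sigma I A \<lesssim> M"
  using assms card_of_Sigma_ordLeq_infinite[of M I A] unfolding lepoll_def card_of_ordLeq by blast

text \<open>A function on \<open>insert a A\<close> is given by its value at \<open>a\<close> and
  its restriction to \<open>A\<close>, and an infinite \<open>M\<close> absorbs binary
  products.\<close>

lemma lepoll_PiE_infinite:
  assumes "infinite M" "B \<lesssim> M" "finite A"
  shows "(A \<rightarrow>\<^sub>E B) \<lesssim> M"
  using assms(3)
proof induction
  case empty
  show ?case using assms(1) by (simp add: finite_lepoll_infinite)
next
  case (insert a A)
  have "(insert a A \<rightarrow>\<^sub>E B) \<lesssim> B \<times> (A \<rightarrow>\<^sub>E B)"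
    unfolding PiE_insert_eq by (rule image_lepoll)
  also have "\<dots> \<lesssim> M"
    using assms(1,2) insert.IH by (rule lepoll_Sigma_infinite)
  finally show ?case .
qed

lemma small_sets_lepoll: "\<lbrakk>small_sets S; M \<in> S; N \<lesssim> M\<rbrakk> \<Longrightarrow> N \<in> S"
  by (auto simp: small_sets_def)

text \<open>The sum of cliques over a finite graph may be infinite, and the bounds above need an
  infinite \<open>M\<close>; hence a small vertex set is first enlarged to an infinite small
  set.\<close>

lemma small_sets_infinite_cover:
  assumes "small_sets S" "N \<in> S"
  obtains M where "M \<in> S" "infinite M" "N \<lesssim> M"
proof (cases "finite N")
  case True
  obtain M where "M \<in> S" "infinite M" using assms(1) by (auto simp: small_sets_def)
  with True that show ?thesis by (blast intro: finite_lepoll_infinite)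
next
  case False
  with assms(2) that show ?thesis by (blast intro: lepoll_refl)
qed

lemma small_sets_finite: "\<lbrakk>small_sets S; finite N\<rbrakk> \<Longrightarrow> N \<in> S"
  unfolding small_sets_def by (meson finite_lepoll_infinite)

section \<open>Elementary description of graphs and their arrows\<close>

lemma graph_homs_iff:
  "f \<in> graph_homs A B \<longleftrightarrow> src f = A \<and> tgt f = B \<and> fn f \<in> pverts A \<rightarrow>\<^sub>E pverts B \<and>
    (\<forall>x y. (x, y) \<in> parcs A \<longrightarrow> (fn f x, fn f y) \<in> parcs B)"
  by (cases f) (auto simp: graph_homs_def)

lemma graph_homs_ext:
  assumes "f \<in> graph_homs A B" "g \<in> graph_homs A B" "\<And>x. x \<in> pverts A \<Longrightarrow> fn f x = fn g x"
  shows "f = g"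
proof -
  have "fn f = fn g"
    using assms by (intro PiE_ext[of "fn f" "pverts A" "\<lambda>_. pverts B"]) (auto simp: graph_homs_iff)
  then show ?thesis using assms(1,2) by (simp add: graph_homs_iff)
qed

lemma Obj_Graph: "A \<in> Obj (Graph S) \<longleftrightarrow> pair_bidirected_digraph A \<and> pverts A \<in> S"
  by (simp add: Graph_def Let_def)

lemma hom_Graph:
  "f \<in> hom (Graph S) A B \<longleftrightarrow> A \<in> Obj (Graph S) \<and> B \<in> Obj (Graph S) \<and> f \<in> graph_homs A B"
  by (auto simp: hom_def Graph_def Let_def graph_homs_iff)

lemma Graph_simps [simp]:
  "Dom (Graph S) = src" "Cod (Graph S) = tgt" "Comp (Graph S) = graph_comp"
  "Ident (Graph S) A = \<lparr>src = A, fn = (\<lambda>x\<in>pverts A. x), tgt = A\<rparr>"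
  by (simp_all add: Graph_def Let_def)

lemma fn_graph_comp: "x \<in> pverts (src f) \<Longrightarrow> fn (graph_comp g f) x = fn g (fn f x)"
  by (simp add: graph_comp_def compose_eq)

lemma pair_graph_iff:
  "pair_graph G \<longleftrightarrow> pair_bidirected_digraph G \<and> finite (pverts G)"
proof
  assume "pair_graph G"
  then interpret pair_graph G .
  show "pair_bidirected_digraph G \<and> finite (pverts G)"
    using pair_bidirected_digraph_axioms pair_finite_verts by blast
next
  assume G: "pair_bidirected_digraph G \<and> finite (pverts G)"
  then interpret pair_bidirected_digraph G by blast
  have "finite (parcs G)"
    using G wellformed' by (intro finite_subset[of "parcs G" "pverts G \<times> pverts G"]) auto
  with G show "pair_graph G" by unfold_locales auto
qed

lemma pair_bidirected_digraph_iff: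
  "pair_bidirected_digraph G \<longleftrightarrow>
    (\<forall>x y. (x, y) \<in> parcs G \<longrightarrow> x \<in> pverts G \<and> y \<in> pverts G \<and> (y, x) \<in> parcs G \<and> x \<noteq> y)"
  (is "_ \<longleftrightarrow> ?R")
proof
  assume "pair_bidirected_digraph G"
  then interpret pair_bidirected_digraph G .
  show ?R using wellformed' arcs_symmetric pair_no_loops by fastforce
next
  assume ?R
  then show "pair_bidirected_digraph G"
    by unfold_locales (auto simp: symmetric_def sym_def)
qed

section \<open>Renaming vertices and isomorphism of graphs\<close>

definition relabel :: "('a \<Rightarrow> 'b) \<Rightarrow> 'a pair_pre_digraph \<Rightarrow> 'b pair_pre_digraph" where
  "relabel g G = \<lparr>pverts = g ` pverts G, parcs = map_prod g g ` parcs G\<rparr>"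

lemma relabel_simps [simp]:
  "pverts (relabel g G) = g ` pverts G" "parcs (relabel g G) = map_prod g g ` parcs G"
  by (simp_all add: relabel_def)

lemma pair_graph_relabel:
  assumes "pair_graph G" "inj_on g (pverts G)"
  shows "pair_graph (relabel g G)"
proof -
  have "pair_bidirected_digraph (relabel g G)"
    unfolding pair_bidirected_digraph_iff
  proof (intro allI impI)
    fix v w assume "(v, w) \<in> parcs (relabel g G)"
    then obtain x y where xy: "(x, y) \<in> parcs G" and vw: "v = g x" "w = g y"
      by auto
    then have "x \<in> pverts G" "y \<in> pverts G" "(y, x) \<in> parcs G" "x \<noteq> y"
      using assms(1) by (auto simp: pair_graph_iff pair_bidirected_digraph_iff)
    then show "v \<in> pverts (relabel g G) \<and> w \<in> pverts (relabel g G) \<and>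
        (w, v) \<in> parcs (relabel g G) \<and> v \<noteq> w"
      using inj_on_eq_iff[OF assms(2)] map_prod_imageI[of y x "parcs G" g g] by (simp add: vw)
  qed
  then show ?thesis using assms(1) by (simp add: pair_graph_iff)
qed

lemma digraph_iso_relabel:
  assumes "pair_graph G" "inj_on g (pverts G)"
  shows "digraph_iso (with_proj G) (with_proj (relabel g G))"
proof -
  \<comment> \<open>An arc of a pair digraph is the pair of its ends, so the action on arcs is
    dictated by \<open>g\<close>, and tail and head must remain the projections.\<close>
  let ?f = "\<lparr>iso_verts = g, iso_arcs = map_prod g g, iso_head = snd, iso_tail = fst\<rparr>"
  interpret pair_graph G by fact
  have "inj_on (map_prod g g) (parcs G)"
    using map_prod_inj_on[OF assms(2,2)] by (rule inj_on_subset) (auto simp: wellformed')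
  then have "pre_digraph.digraph_isomorphism (with_proj G) ?f"
    using assms(2) wf_digraph_axioms by (simp add: pre_digraph.digraph_isomorphism_def)
  moreover have "with_proj (relabel g G) = app_iso ?f (with_proj G)"
    by (simp add: with_proj_def app_iso_def)
  ultimately show ?thesis unfolding digraph_iso_def by blast
qed

text \<open>As the target is of the form \<open>with_proj H\<close>, the tail and head maps of the
  isomorphism have to be \<open>fst\<close> and \<open>snd\<close>. Compatibility with the ends then
  forces its action on arcs to be the one induced by its vertex map.\<close>

lemma digraph_iso_imp_relabel:
  assumes "digraph_iso (with_proj G) (with_proj H)"
  obtains g where "inj_on g (pverts G)" "H = relabel g G"
proof -
  obtain f where f: "pre_digraph.digraph_isomorphism (with_proj G) f"
    and H: "with_proj H = app_iso f (with_proj G)"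
    using assms by (auto simp: digraph_iso_def)
  have ends: "iso_tail f = fst" "iso_head f = snd"
    using arg_cong[OF H, of tail] arg_cong[OF H, of head] by simp_all
  have arcs: "iso_arcs f a = map_prod (iso_verts f) (iso_verts f) a" if "a \<in> parcs G" for a
    using f that ends by (auto simp: pre_digraph.digraph_isomorphism_def prod_eq_iff)
  have "pverts H = iso_verts f ` pverts G"
    using arg_cong[OF H, of verts] by simp
  moreover have "parcs H = map_prod (iso_verts f) (iso_verts f) ` parcs G"
    using arg_cong[OF H, of arcs] arcs by simp
  ultimately have "H = relabel (iso_verts f) G" by simp
  moreover have "inj_on (iso_verts f) (pverts G)"
    using f by (simp add: pre_digraph.digraph_isomorphism_def)
  ultimately show ?thesis using that by blast
qed

text \<open>The arrow undoes one labelling and applies the other; exchanging \<open>g\<close> and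
  \<open>g'\<close> gives the inverse.\<close>

lemma relabel_iso_arrow:
  assumes G: "pair_graph G" and g: "inj_on g (pverts G)" and g': "inj_on g' (pverts G)"
    and SG: "relabel g G \<in> Obj (Graph S)" "relabel g' G \<in> Obj (Graph S)"
  obtains h k where "h \<in> hom (Graph S) (relabel g G) (relabel g' G)"
    "k \<in> hom (Graph S) (relabel g' G) (relabel g G)"
    "graph_comp k h = Ident (Graph S) (relabel g G)"
    "graph_comp h k = Ident (Graph S) (relabel g' G)"
proof -
  let ?a = "\<lambda>g g'. \<lparr>src = relabel g G,
    fn = (\<lambda>x\<in>pverts (relabel g G). g' (the_inv_into (pverts G) g x)), tgt = relabel g' G\<rparr>"
  interpret pair_graph G by fact
  have hom: "?a g g' \<in> graph_homs (relabel g G) (relabel g' G)" if "inj_on g (pverts G)" for g g'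
    unfolding graph_homs_iff
  proof (intro conjI allI impI)
    fix v w assume "(v, w) \<in> parcs (relabel g G)"
    then obtain x y where xy: "(x, y) \<in> parcs G" and vw: "v = g x" "w = g y"
      by auto
    show "(fn (?a g g') v, fn (?a g g') w) \<in> parcs (relabel g' G)"
      using wellformed'[OF xy] map_prod_imageI[OF xy, of g' g']
      by (simp add: vw the_inv_into_f_f[OF that])
  qed (auto simp: the_inv_into_f_f[OF that])
  have comp: "graph_comp (?a g' g) (?a g g') = Ident (Graph S) (relabel g G)"
    if "inj_on g (pverts G)" "inj_on g' (pverts G)" for g g'
    by (auto simp: graph_comp_def compose_def fun_eq_iff the_inv_into_f_f[OF that(1)]
        the_inv_into_f_f[OF that(2)] dest: inj_onD[OF that(2)])
  show ?thesis
  proof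
    show "?a g g' \<in> hom (Graph S) (relabel g G) (relabel g' G)"
      "?a g' g \<in> hom (Graph S) (relabel g' G) (relabel g G)"
      using SG hom[OF g] hom[OF g'] by (simp_all only: hom_Graph simp_thms)
  qed (rule comp[OF g g'] comp[OF g' g])+
qed

section \<open>Subdivided cliques and the number of their maps into a graph\<close>

lemma pair_graph_subdivided_clique: "pair_graph (subdivided_clique n p)"
proof -
  have "pair_bidirected_digraph (subdivided_clique n p)"
    unfolding pair_bidirected_digraph_iff
  proof (intro allI impI)
    fix v w assume "(v, w) \<in> parcs (subdivided_clique n p)"
    then obtain i j k where ijk: "i < j" "j < n" "k \<le> p"
      and vw: "(v, w) = (path_vertex p i j k, path_vertex p i j (Suc k)) \<or>
        (w, v) = (path_vertex p i j k, path_vertex p i j (Suc k))"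
      unfolding subdivided_clique_def Let_def by auto
    \<comment> \<open>For \<open>p = 0\<close> this step runs directly from \<open>Branch i\<close>
      to \<open>Branch j\<close>, and it is no loop because \<open>i < j\<close>.\<close>
    have "path_vertex p i j k \<noteq> path_vertex p i j (Suc k)"
      using ijk by (simp add: path_vertex_def)
    moreover have "path_vertex p i j m \<in> pverts (subdivided_clique n p)" if "m \<le> Suc p" for m
      using ijk that by (simp add: path_vertex_def subdivided_clique_def Let_def)
    then have "path_vertex p i j k \<in> pverts (subdivided_clique n p)"
      "path_vertex p i j (Suc k) \<in> pverts (subdivided_clique n p)"
      using ijk by simp_all
    moreover have "(path_vertex p i j k, path_vertex p i j (Suc k)) \<in> parcs (subdivided_clique n p)"
      "(path_vertex p i j (Suc k), path_vertex p i j k) \<in> parcs (subdivided_clique n p)"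
      using ijk unfolding subdivided_clique_def Let_def by auto
    ultimately show "v \<in> pverts (subdivided_clique n p) \<and> w \<in> pverts (subdivided_clique n p) \<and>
        (w, v) \<in> parcs (subdivided_clique n p) \<and> v \<noteq> w"
      using vw by auto
  qed
  moreover have "pverts (subdivided_clique n p) \<subseteq>
      Branch ` {..<n} \<union> (\<lambda>(i, j, k). Subdiv i j k) ` ({..<n} \<times> {..<n} \<times> {..p})"
    by (auto simp: subdivided_clique_def Let_def image_iff)
  then have "finite (pverts (subdivided_clique n p))"
    by (rule finite_subset) simp
  ultimately show ?thesis by (simp add: pair_graph_iff)
qed

text \<open>Names the choice made inside \<open>subdivK\<close>, which is the same injection for all
  \<open>n\<close> and \<open>p\<close>.\<close>

definition label :: "subdiv_vertex \<Rightarrow> 'u" where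
  "label = (SOME e. inj e)"

lemma subdivK_eq_relabel: "subdivK n p = relabel label (subdivided_clique n p)"
  by (simp add: subdivK_def relabel_def label_def Let_def)

text \<open>There are only countably many values of \<open>subdiv_vertex\<close>, so they embed into
  any infinite type and the choice by \<open>SOME\<close> succeeds.\<close>

lemma inj_label:
  assumes "infinite (UNIV :: 'u set)"
  shows "inj (label :: subdiv_vertex \<Rightarrow> 'u)"
proof -
  obtain c :: "nat \<Rightarrow> 'u" where c: "inj c"
    using assms infinite_countable_subset by blast
  let ?code = "\<lambda>v. case v of Branch i \<Rightarrow> to_nat (Inl i :: nat + nat \<times> nat \<times> nat)
    | Subdiv i j k \<Rightarrow> to_nat (Inr (i, j, k) :: nat + nat \<times> nat \<times> nat)"
  have "inj ?code"
    by (auto simp: inj_def split: subdiv_vertex.splits)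
  then have "inj (c \<circ> ?code)"
    using c by (rule inj_compose[rotated])
  then show ?thesis
    unfolding label_def by (rule someI[of inj])
qed

lemma small_sets_infinite_UNIV:
  fixes S :: "'u set set"
  assumes "small_sets S"
  shows "infinite (UNIV :: 'u set)"
proof -
  obtain M where "M \<in> S" "infinite M" using assms by (auto simp: small_sets_def)
  then show ?thesis using infinite_super[OF subset_UNIV] by metis
qed

lemma pair_graph_subdivK:
  assumes "infinite (UNIV :: 'u set)"
  shows "pair_graph (subdivK n p :: 'u pair_pre_digraph)"
  unfolding subdivK_eq_relabel
  by (intro pair_graph_relabel pair_graph_subdivided_clique inj_on_subset[OF inj_label[OF assms]]) simp

lemma pair_graph_Cli: "\<lbrakk>infinite (UNIV :: 'u set); (A :: 'u pair_pre_digraph) \<in> Cli p\<rbrakk> \<Longrightarrow> pair_graph A"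
  by (auto simp: Cli_def pair_graph_subdivK)

lemma pair_graph_in_Obj: "\<lbrakk>small_sets S; pair_graph A\<rbrakk> \<Longrightarrow> A \<in> Obj (Graph S)"
  by (auto simp: Obj_Graph pair_graph_iff small_sets_finite)

text \<open>There are countably many cliques, each of them finite. Hence each has at most as many
  maps to \<open>B\<close> as \<open>M\<close> has elements, and every map contributes finitely many
  points; an infinite \<open>M\<close> absorbs the union and the sum.\<close>

lemma summand_points_lepoll:
  fixes B :: "'u pair_pre_digraph" and M :: "'u set"
  assumes "infinite M" "pverts B \<lesssim> M"
  shows "summand_points p B \<lesssim> M"
proof -
  have inf: "infinite (UNIV :: 'u set)"
    by (rule infinite_super[OF subset_UNIV assms(1)])
  have fin: "finite (pverts A)" if "(A :: 'u pair_pre_digraph) \<in> Cli p" for A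
    using pair_graph_Cli[OF inf that] by (simp add: pair_graph_iff)
  have "(Cli p :: 'u pair_pre_digraph set) \<lesssim> (UNIV :: nat set)"
    unfolding lepoll_iff by (rule exI[of _ "\<lambda>n. subdivK n p"]) (unfold Cli_def, blast)
  also have "\<dots> \<lesssim> M" using assms(1) infinite_le_lepoll by blast
  finally have Cli: "(Cli p :: 'u pair_pre_digraph set) \<lesssim> M" .
  have "graph_homs A B \<lesssim> M" if "A \<in> Cli p" for A
  proof -
    have "inj_on fn (graph_homs A B)"
      by (rule inj_onI, rule graph_homs_ext[of _ A B]) simp_all
    moreover have "fn ` graph_homs A B \<subseteq> pverts A \<rightarrow>\<^sub>E pverts B"
      by (auto simp: graph_homs_iff)
    ultimately have "graph_homs A B \<lesssim> (pverts A \<rightarrow>\<^sub>E pverts B)"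
      unfolding lepoll_def by blast
    also have "\<dots> \<lesssim> M" by (rule lepoll_PiE_infinite[OF assms fin[OF that]])
    finally show ?thesis .
  qed
  then have "clique_homs p B \<lesssim> M"
    unfolding clique_homs_def by (rule lepoll_UN_infinite[OF assms(1) Cli])
  moreover have "pverts (src f) \<lesssim> M" if "f \<in> clique_homs p B" for f
  proof -
    have "src f \<in> Cli p" using that by (auto simp: clique_homs_def graph_homs_iff)
    then show ?thesis by (rule finite_lepoll_infinite[OF assms(1) fin])
  qed
  ultimately show ?thesis
    unfolding summand_points_def by (rule lepoll_Sigma_infinite[OF assms(1)])
qed

section \<open>The sum of cliques over a graph and its universal property\<close>

context
  fixes S :: "'u set set" and p :: nat and B :: "'u pair_pre_digraph"
  assumes S: "small_sets S" and B: "B \<in> Obj (Graph S)"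
begin

text \<open>One cardinality bound serves twice: it provides an injection for the \<open>SOME\<close>
  in \<open>tag\<close> to pick, and it makes the image a small set.\<close>

lemma inj_on_tag: "inj_on (tag p B) (summand_points p B)"
  and tag_image_small: "tag p B ` summand_points p B \<in> S"
proof -
  have "pverts B \<in> S" using B by (simp add: Obj_Graph)
  then obtain M where M: "M \<in> S" "infinite M" "pverts B \<lesssim> M"
    by (rule small_sets_infinite_cover[OF S])
  have le: "summand_points p B \<lesssim> M" by (rule summand_points_lepoll[OF M(2,3)])
  then obtain e :: "'u graph_arrow \<times> 'u \<Rightarrow> 'u" where "inj_on e (summand_points p B)"
    by (auto simp: lepoll_def)
  then show "inj_on (tag p B) (summand_points p B)"
    unfolding tag_def by (rule someI[where P = "\<lambda>e. inj_on e (summand_points p B)"])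
  show "tag p B ` summand_points p B \<in> S"
    by (rule small_sets_lepoll[OF S M(1) lepoll_trans[OF image_lepoll le]])
qed

text \<open>Cliques are finite and therefore objects of \<open>Graph S\<close>, so the concrete
  index set agrees with the one in \<open>discrete_density\<close>.\<close>

lemma clique_homs_iff: "f \<in> clique_homs p B \<longleftrightarrow> (\<exists>A\<in>Cli p. f \<in> hom (Graph S) A B)"
proof -
  have "A \<in> Obj (Graph S)" if "A \<in> Cli p" for A
    using pair_graph_in_Obj[OF S] pair_graph_Cli[OF small_sets_infinite_UNIV[OF S] that] .
  then show ?thesis using B by (auto simp: clique_homs_def hom_Graph)
qed

text \<open>Arcs inherit symmetry from the summand they come from, and injectivity of
  \<open>tag\<close> keeps their ends distinct.\<close>

lemma clique_sum_in_Obj: "clique_sum p B \<in> Obj (Graph S)"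
proof -
  have src: "pair_bidirected_digraph (src f)" if "f \<in> clique_homs p B" for f
    using that by (auto simp: clique_homs_iff hom_Graph Obj_Graph graph_homs_iff)
  have tag: "tag p B (f, x) = tag p B (g, y) \<longleftrightarrow> f = g \<and> x = y"
    if "f \<in> clique_homs p B" "g \<in> clique_homs p B" "x \<in> pverts (src f)" "y \<in> pverts (src g)"
    for f g x y
    using inj_on_eq_iff[OF inj_on_tag, of "(f, x)" "(g, y)"] that by (simp add: summand_points_def)
  have "pair_bidirected_digraph (clique_sum p B)"
    unfolding pair_bidirected_digraph_iff
  proof (intro allI impI)
    fix v w assume "(v, w) \<in> parcs (clique_sum p B)"
    then obtain f x y where f: "f \<in> clique_homs p B" and xy: "(x, y) \<in> parcs (src f)"
      and vw: "v = tag p B (f, x)" "w = tag p B (f, y)"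
      by (auto simp: clique_sum_def)
    then have "x \<in> pverts (src f)" "y \<in> pverts (src f)" "(y, x) \<in> parcs (src f)" "x \<noteq> y"
      using src[OF f] by (auto simp: pair_bidirected_digraph_iff)
    then show "v \<in> pverts (clique_sum p B) \<and> w \<in> pverts (clique_sum p B) \<and>
        (w, v) \<in> parcs (clique_sum p B) \<and> v \<noteq> w"
      using f xy vw tag[OF f f] by (auto simp: clique_sum_def summand_points_def)
  qed
  then show ?thesis
    using tag_image_small by (simp add: Obj_Graph clique_sum_def)
qed

lemma inclusion_in_hom:
  assumes "A \<in> Cli p" "f \<in> hom (Graph S) A B"
  shows "inclusion p f \<in> hom (Graph S) A (clique_sum p B)"
proof -
  have f: "f \<in> clique_homs p B" using assms clique_homs_iff by blast
  have "src f = A" "tgt f = B" and A: "pair_bidirected_digraph A"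
    using assms(2) by (auto simp: hom_Graph graph_homs_iff Obj_Graph)
  then show ?thesis
    using assms(2) f A clique_sum_in_Obj unfolding hom_Graph
    by (auto simp: graph_homs_iff inclusion_def clique_sum_def summand_points_def
        pair_bidirected_digraph_iff)
qed

lemma copair_tag:
  assumes "f \<in> clique_homs p B" "x \<in> pverts (src f)"
  shows "fn (copair p B Y k) (tag p B (f, x)) = fn (k f) x"
proof -
  have "(f, x) \<in> summand_points p B" using assms by (simp add: summand_points_def)
  then show ?thesis
    by (simp add: copair_def clique_sum_def the_inv_into_f_f[OF inj_on_tag])
qed

text \<open>Each arc of the sum comes from an arc of a single summand, where \<open>k f\<close>
  preserves it.\<close>

lemma copair_in_hom:
  assumes Y: "Y \<in> Obj (Graph S)"
    and k: "\<And>A f. \<lbrakk>A \<in> Cli p; f \<in> hom (Graph S) A B\<rbrakk> \<Longrightarrow> k f \<in> hom (Graph S) A Y"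
  shows "copair p B Y k \<in> hom (Graph S) (clique_sum p B) Y"
proof -
  have k: "k f \<in> graph_homs (src f) Y" if "f \<in> clique_homs p B" for f
    using that k by (auto simp: clique_homs_iff hom_Graph graph_homs_iff)
  have wf: "x \<in> pverts (src f) \<and> y \<in> pverts (src f)"
    if "f \<in> clique_homs p B" "(x, y) \<in> parcs (src f)" for f x y
    using that by (auto simp: clique_homs_iff hom_Graph graph_homs_iff Obj_Graph
        pair_bidirected_digraph_iff)
  have ext: "fn (copair p B Y k) \<in> extensional (pverts (clique_sum p B))"
    by (simp add: copair_def)
  have "fn (copair p B Y k) z \<in> pverts Y" if "z \<in> pverts (clique_sum p B)" for z
    using that k by (auto simp: clique_sum_def summand_points_def copair_tag graph_homs_iff PiE_iff)
  moreover have "(fn (copair p B Y k) v, fn (copair p B Y k) w) \<in> parcs Y"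
    if "(v, w) \<in> parcs (clique_sum p B)" for v w
    using that k wf by (auto simp: clique_sum_def copair_tag graph_homs_iff)
  ultimately show ?thesis
    using Y clique_sum_in_Obj ext
    by (auto simp: hom_Graph graph_homs_iff PiE_iff) (simp_all add: copair_def)
qed

text \<open>Arrows are equal only if their functions also agree off the source; both functions here
  are extensional, so the vertices of \<open>A\<close> decide.\<close>

lemma copair_inclusion:
  assumes "Y \<in> Obj (Graph S)"
    and k: "\<And>A f. \<lbrakk>A \<in> Cli p; f \<in> hom (Graph S) A B\<rbrakk> \<Longrightarrow> k f \<in> hom (Graph S) A Y"
    and f: "A \<in> Cli p" "f \<in> hom (Graph S) A B"
  shows "graph_comp (copair p B Y k) (inclusion p f) = k f"
proof -
  have f': "f \<in> clique_homs p B" "src f = A" "tgt f = B"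
    using f clique_homs_iff by (auto simp: hom_Graph graph_homs_iff)
  have kf: "src (k f) = A" "tgt (k f) = Y" "fn (k f) \<in> extensional (pverts A)"
    using k[OF f] by (auto simp: hom_Graph graph_homs_iff PiE_iff)
  have "fn (graph_comp (copair p B Y k) (inclusion p f)) = fn (k f)"
  proof (rule extensionalityI[of _ "pverts A"])
    show "fn (graph_comp (copair p B Y k) (inclusion p f)) \<in> extensional (pverts A)"
      by (simp add: graph_comp_def inclusion_def f')
    fix x assume "x \<in> pverts A"
    then show "fn (graph_comp (copair p B Y k) (inclusion p f)) x = fn (k f) x"
      using f' copair_tag[OF f'(1)] by (simp add: fn_graph_comp inclusion_def)
  qed (rule kf)
  then show ?thesis
    using kf f' by (simp add: graph_comp_def inclusion_def copair_def)
qed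

text \<open>Every vertex of the sum lies in the image of some coprojection.\<close>

lemma clique_sum_ext:
  assumes g: "g \<in> hom (Graph S) (clique_sum p B) Y" and h: "h \<in> hom (Graph S) (clique_sum p B) Y"
    and eq: "\<And>A f. \<lbrakk>A \<in> Cli p; f \<in> hom (Graph S) A B\<rbrakk>
      \<Longrightarrow> graph_comp g (inclusion p f) = graph_comp h (inclusion p f)"
  shows "g = h"
proof (rule graph_homs_ext)
  show "g \<in> graph_homs (clique_sum p B) Y" "h \<in> graph_homs (clique_sum p B) Y"
    using g h by (simp_all add: hom_Graph)
  fix z assume "z \<in> pverts (clique_sum p B)"
  then obtain f x where f: "f \<in> clique_homs p B" and x: "x \<in> pverts (src f)"
    and z: "z = tag p B (f, x)"
    by (auto simp: clique_sum_def summand_points_def)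
  obtain A where A: "A \<in> Cli p" "f \<in> hom (Graph S) A B" using f clique_homs_iff by blast
  then have "tgt f = B" by (simp add: hom_Graph graph_homs_iff)
  moreover have "fn (graph_comp g (inclusion p f)) x = fn (graph_comp h (inclusion p f)) x"
    using eq[OF A] by simp
  ultimately show "fn g z = fn h z"
    using x z by (simp add: fn_graph_comp inclusion_def)
qed

end

section \<open>Specialisation to graphs and the density criterion\<close>

lemma discrete_density_Graph:
  assumes "small_sets S" "category (Graph S)"
  shows "discrete_density (Graph S) (Cli p) (clique_sum p) (inclusion p) (copair p)"
proof -
  interpret category "Graph S" by fact
  show ?thesis
  proof
    fix B assume "B \<in> Obj (Graph S)"
    then show "clique_sum p B \<in> Obj (Graph S)" by (rule clique_sum_in_Obj[OF assms(1)])
  next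
    fix A f B assume "A \<in> Cli p" and f: "f \<in> hom (Graph S) A B"
    then show "inclusion p f \<in> hom (Graph S) A (clique_sum p B)"
      by (rule inclusion_in_hom[OF assms(1) hom_Obj_Cod[OF f]])
  next
    fix B Y k assume "B \<in> Obj (Graph S)" "Y \<in> Obj (Graph S)"
      "\<And>A f. \<lbrakk>A \<in> Cli p; f \<in> hom (Graph S) A B\<rbrakk> \<Longrightarrow> k f \<in> hom (Graph S) A Y"
    then show "copair p B Y k \<in> hom (Graph S) (clique_sum p B) Y"
      by (rule copair_in_hom[OF assms(1)])
  next
    fix Y B k A f assume "Y \<in> Obj (Graph S)"
      "\<And>A f. \<lbrakk>A \<in> Cli p; f \<in> hom (Graph S) A B\<rbrakk> \<Longrightarrow> k f \<in> hom (Graph S) A Y"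
      "A \<in> Cli p" and f: "f \<in> hom (Graph S) A B"
    then show "copair p B Y k \<odot>\<^bsub>Graph S\<^esub> inclusion p f = k f"
      unfolding Graph_simps by (rule copair_inclusion[OF assms(1) hom_Obj_Cod[OF f]])
  next
    fix g B Y h
    assume gh: "g \<in> hom (Graph S) (clique_sum p B) Y" "h \<in> hom (Graph S) (clique_sum p B) Y"
      and B: "B \<in> Obj (Graph S)"
      and eq: "\<And>A f. \<lbrakk>A \<in> Cli p; f \<in> hom (Graph S) A B\<rbrakk>
        \<Longrightarrow> g \<odot>\<^bsub>Graph S\<^esub> inclusion p f = h \<odot>\<^bsub>Graph S\<^esub> inclusion p f"
    show "g = h"
      by (rule clique_sum_ext[OF assms(1) B gh eq[unfolded Graph_simps]])
  qed
qed

text \<open>In \<open>Graph S\<close> the maps \<open>Dom\<close>, \<open>Cod\<close> and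
  \<open>Comp\<close> are \<open>src\<close>, \<open>tgt\<close> and \<open>graph_comp\<close>, so
  both records have the same fields.\<close>

lemma density_comonad_eq:
  assumes "discrete_density (Graph S) (Cli p) (clique_sum p) (inclusion p) (copair p)"
  shows "density_comonad p
    = discrete_density.density (Graph S) (clique_sum p) (inclusion p) (copair p)"
  by (simp add: density_comonad_def discrete_density.density_def[OF assms])

theorem proposition5p6:
  fixes S :: "'u set set"
    and C :: "('u pair_pre_digraph, 'u graph_arrow) comonad_data"
    and \<Delta> :: "'u pair_pre_digraph set"
  assumes "small_sets S"
    and "comonad (Graph S) C"
    and "\<forall>G\<in>\<Delta>. pair_graph G"
    and "monotone_class \<Delta>"
    and "classifies S C \<Delta>"
  shows "nowhere_dense \<Delta> \<longleftrightarrow>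
    (\<forall>p. \<not> (\<exists>l. comonad_morphism (Graph S) (density_comonad p) C l))"
proof -
  interpret C: comonad "Graph S" C by fact
  have inf: "infinite (UNIV :: 'u set)" using small_sets_infinite_UNIV[OF assms(1)] .
  have label: "inj_on (label :: subdiv_vertex \<Rightarrow> 'u) V" for V
    using inj_label[OF inf] by (rule inj_on_subset) simp
  note K = pair_graph_subdivided_clique
  have in_Delta: "G \<in> \<Delta> \<longleftrightarrow> (\<exists>\<alpha>. coalgebra (Graph S) C G \<alpha>)" if "pair_graph G" for G
    using assms(5) that by (simp add: classifies_def)
  \<comment> \<open>Density allows any copy of the subdivided clique, whereas \<open>Cli p\<close>
    contains one chosen copy. For \<open>\<Delta>\<close> the two conditions coincide.\<close>
  have iso: "subdivK n p \<in> \<Delta> \<longleftrightarrow> (\<exists>G\<in>\<Delta>. \<exists>H. subgraph (with_proj H) (with_proj G) \<and>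
      digraph_iso (with_proj (subdivided_clique n p)) (with_proj H))" (is "_ \<longleftrightarrow> ?R") for n p
  proof
    assume G: "subdivK n p \<in> \<Delta>"
    have "wf_digraph (with_proj (subdivK n p :: 'u pair_pre_digraph))"
      using pair_graph_subdivK[OF inf, of n p]
      by (auto simp: wf_digraph_wp_iff pair_graph_iff pair_bidirected_digraph_iff pair_wf_digraph_def)
    then have "subgraph (with_proj (subdivK n p)) (with_proj (subdivK n p :: 'u pair_pre_digraph))"
      by (simp add: subgraph_def compatible_def)
    moreover have "digraph_iso (with_proj (subdivided_clique n p))
        (with_proj (subdivK n p :: 'u pair_pre_digraph))"
      unfolding subdivK_eq_relabel by (rule digraph_iso_relabel[OF K label])
    ultimately show ?R using G by blast
  next
    assume ?R
    then obtain G H where G: "G \<in> \<Delta>" and sub: "subgraph (with_proj H) (with_proj G)"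
      and iso: "digraph_iso (with_proj (subdivided_clique n p)) (with_proj H)"
      by blast
    obtain g where g: "inj_on g (pverts (subdivided_clique n p))"
      and Hg: "H = relabel g (subdivided_clique n p)"
      using digraph_iso_imp_relabel[OF iso] .
    \<comment> \<open>\<open>monotone_class\<close> only yields members that are graphs;
      \<open>H\<close> is one because it is a relabelled clique.\<close>
    have H: "pair_graph H" unfolding Hg by (rule pair_graph_relabel[OF K g])
    then have "H \<in> \<Delta>"
      using assms(4) G sub by (auto simp: monotone_class_def)
    \<comment> \<open>Monotonicity reaches actual subgraphs only. The passage from \<open>H\<close>
      to the chosen copy goes through coalgebras.\<close>
    then obtain \<alpha> where \<alpha>: "coalgebra (Graph S) C H \<alpha>" using in_Delta[OF H] by blast
    obtain h k where "h \<in> hom (Graph S) H (subdivK n p)" "k \<in> hom (Graph S) (subdivK n p) H"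
      "graph_comp k h = Ident (Graph S) H" "graph_comp h k = Ident (Graph S) (subdivK n p)"
      using relabel_iso_arrow[OF K g label, of S] pair_graph_in_Obj[OF assms(1) H]
        pair_graph_in_Obj[OF assms(1) pair_graph_subdivK[OF inf, of n p]]
      unfolding Hg subdivK_eq_relabel by blast
    then have "\<exists>\<alpha>. coalgebra (Graph S) C (subdivK n p) \<alpha>"
      \<comment> \<open>\<open>Graph_simps(4)\<close> would unfold identities, so that the equations
        for \<open>h\<close> and \<open>k\<close> no longer match the premises of the transport
        lemma.\<close>
      using C.coalgebra_transport[OF \<alpha>] by (auto simp del: Graph_simps(4))
    then show "subdivK n p \<in> \<Delta>" using in_Delta[OF pair_graph_subdivK[OF inf]] by blast
  qed
  have "(\<exists>l. comonad_morphism (Graph S) (density_comonad p) C l) \<longleftrightarrow>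
      (\<forall>n\<ge>1. subdivK n p \<in> \<Delta>)" for p
  proof -
    interpret D: discrete_density "Graph S" "Cli p" "clique_sum p" "inclusion p" "copair p"
      using discrete_density_Graph[OF assms(1) C.category_axioms] .
    have Cli: "Cli p \<subseteq> Obj (Graph S)"
      using pair_graph_Cli[OF inf] pair_graph_in_Obj[OF assms(1)] by blast
    show ?thesis
      unfolding density_comonad_eq[OF D.discrete_density_axioms]
        D.comonad_morphism_iff_coalgebras[OF assms(2) Cli]
      using in_Delta[OF pair_graph_subdivK[OF inf]] by (auto simp: Cli_def)
  qed
  then show ?thesis
    \<comment> \<open>Read backwards, \<open>iso\<close> turns being somewhere dense into the
      statement that, for some \<open>p\<close>, every \<open>subdivK n p\<close> with
      \<open>n \<ge> 1\<close> lies in \<open>\<Delta>\<close>.\<close>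
    unfolding nowhere_dense_def somewhere_dense_def iso[symmetric] by blast
qed

end
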